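(* Let $n\ge 1$ and let $\mathcal E$ be a family in some Boolean algebra $\mathfrak A$ such that $\mathcal E$ contains no independent family of size $n$. Fix $r\ge 1$ and set $$I(n,r):=\min\left\{s\in\omega:\ \binom{rs}{0}+\binom{rs}{1}+\dots+\binom{rs}{n-1}<2^s\right\}.$$ Then, for any Boolean polynomial $p(x_1,x_2,\dots,x_r)$, the family $$p(\mathcal E)=\{p(a_1,\dots,a_r): a_1,\dots,a_r\in\mathcal E\}$$ contains no independent sequence of length $I(n,r)$.
   Context: $\omega$ denotes the set of natural numbers. A family $\{a_i:i\in I\}$ in a Boolean algebra is independent if $\bigcap_{i\in I'}a_i\cap\bigcap_{i\in I''}a_i^c\neq 0$ for all finite disjoint $I',I''\subseteq I$. A Boolean polynomial $p(x_1,\dots,x_r)$ is an expression built from the variables by the operations of meet, join and complement. *)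

theory Defs
  imports Complex_Main
begin

(* The meet of a finite set; inserting top makes the empty meet equal to top,
   since Inf_fin is unspecified on the empty set. *)
definition finite_meet :: "'a::boolean_algebra set \<Rightarrow> 'a" where
  "finite_meet A = Inf_fin (insert top A)"

(* Independence is a property of the indexed family. Two indices carrying the same
   element violate it (take I1 = {i}, I2 = {j}), so an independent family is injective. *)
definition independent_family :: "('i \<Rightarrow> 'a::boolean_algebra) \<Rightarrow> 'i set \<Rightarrow> bool" where
  "independent_family a I \<longleftrightarrow>
     (\<forall>I1 I2. finite I1 \<and> finite I2 \<and> I1 \<subseteq> I \<and> I2 \<subseteq> I \<and> I1 \<inter> I2 = {} \<longrightarrow>
        inf (finite_meet (a ` I1)) (finite_meet ((\<lambda>i. - a i) ` I2)) \<noteq> bot)"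

definition contains_independent :: "'a::boolean_algebra set \<Rightarrow> nat \<Rightarrow> bool" where
  "contains_independent E n \<longleftrightarrow>
     (\<exists>a :: nat \<Rightarrow> 'a. (\<forall>i<n. a i \<in> E) \<and> independent_family a {..<n})"

datatype (bpoly_vars: 'v) bpoly =
    Var 'v
  | Meet "'v bpoly" "'v bpoly"
  | Join "'v bpoly" "'v bpoly"
  | Compl "'v bpoly"

primrec bpoly_eval :: "('v \<Rightarrow> 'a::boolean_algebra) \<Rightarrow> 'v bpoly \<Rightarrow> 'a" where
  "bpoly_eval a (Var i) = a i"
| "bpoly_eval a (Meet p q) = inf (bpoly_eval a p) (bpoly_eval a q)"
| "bpoly_eval a (Join p q) = sup (bpoly_eval a p) (bpoly_eval a q)"
| "bpoly_eval a (Compl p) = - bpoly_eval a p"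

(* p(E), for p a polynomial in the variables 1, ..., r. *)
definition bpoly_image :: "nat \<Rightarrow> nat bpoly \<Rightarrow> 'a::boolean_algebra set \<Rightarrow> 'a set" where
  "bpoly_image r p E = {bpoly_eval a p | a. \<forall>i\<in>{1..r}. a i \<in> E}"

(* I(n, r). The minimum exists: the left-hand side is polynomial in s. *)
definition indep_bound :: "nat \<Rightarrow> nat \<Rightarrow> nat" where
  "indep_bound n r = (LEAST s. (\<Sum>k<n. (r * s) choose k) < 2 ^ s)"

end

theory Submission
  imports Defs
begin

text \<open>
  Finitely many elements of a Boolean algebra cut it into cells: a set \<open>S\<close> of indices is
  a cell if some nonzero element lies below the members indexed by \<open>S\<close> and below the
  complements of all others. A finite family is independent exactly if every set of
  indices is a cell, and \<open>n\<close> of its members form an independent family exactly if the system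
  of cells shatters their indices.

  Suppose that \<open>s = I(n, r)\<close> values of \<open>p\<close> on \<open>\<E>\<close> were independent. They use at most \<open>r * s\<close>
  elements of \<open>\<E>\<close>, and by \<open>below_bpoly_eval\<close> a cell of these elements determines, for each
  value of \<open>p\<close>, whether it lies below that value or below its complement. So every one of
  the \<open>2 ^ s\<close> cells of the values comes from a cell of the arguments, and the arguments have
  at least \<open>2 ^ s > (\<Sum>k<n. (r * s) choose k)\<close> cells. By the Sauer-Shelah lemma
  (\<open>sauer_shelah\<close>) the system of cells shatters a set of size \<open>n\<close>, which gives \<open>n\<close> independent
  elements of \<open>\<E>\<close>.
\<close>

section \<open>The Sauer-Shelah lemma\<close>

definition shatters :: "'i set set \<Rightarrow> 'i set \<Rightarrow> bool" where
  "shatters F K \<longleftrightarrow> (\<forall>T\<subseteq>K. \<exists>S\<in>F. S \<inter> K = T)"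

lemma shatters_subset:
  assumes "shatters F K" and "L \<subseteq> K"
  shows "shatters F L"
  unfolding shatters_def
proof (intro allI impI)
  fix T assume "T \<subseteq> L"
  with assms obtain S where "S \<in> F" and "S \<inter> K = T"
    unfolding shatters_def by (meson order_trans)
  moreover from this \<open>T \<subseteq> L\<close> \<open>L \<subseteq> K\<close> have "S \<inter> L = T" by blast
  ultimately show "\<exists>S\<in>F. S \<inter> L = T" by blast
qed

text \<open>
  This is Pajor's form of the lemma, by induction on the ground set. Splitting the sets of \<open>F\<close> by whether they contain the new
  point \<open>x\<close> gives two systems on the smaller ground set. What either of them shatters is shattered by
  \<open>F\<close>, and what both shatter is shattered by \<open>F\<close> also after adding \<open>x\<close>, so sets counted
  twice are accounted for.
\<close>

lemma pajor:
  assumes "finite J" and "F \<subseteq> Pow J"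
  shows "card F \<le> card {K. K \<subseteq> J \<and> shatters F K}"
  using assms
proof (induction J arbitrary: F rule: finite_induct)
  case empty
  then have "F = {} \<or> F = {{}}" by (simp add: subset_singleton_iff)
  then show ?case
  proof
    assume "F = {{}}"
    then have "{K. K \<subseteq> {} \<and> shatters F K} = {{}}"
      by (auto simp: shatters_def)
    with \<open>F = {{}}\<close> show ?thesis by simp
  qed simp
next
  case (insert x J)
  define F0 where "F0 = {S \<in> F. x \<notin> S}"
  define F1 where "F1 = (\<lambda>S. S - {x}) ` {S \<in> F. x \<in> S}"
  define sh where "sh G = {K. K \<subseteq> J \<and> shatters G K}" for G
  have finF: "finite F" using insert finite_subset by blast
  have F0J: "F0 \<subseteq> Pow J" and F1J: "F1 \<subseteq> Pow J"
    using insert.prems unfolding F0_def F1_def by auto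
  have fin_sh: "finite (sh G)" for G
    unfolding sh_def using \<open>finite J\<close> by simp
  have F1_iff: "S \<in> F1 \<longleftrightarrow> insert x S \<in> F" if "x \<notin> S" for S
    using that unfolding F1_def by (auto simp: insert_absorb image_iff)
  have sh0: "shatters F K" if "shatters F0 K" for K
    using that unfolding shatters_def F0_def by blast
  have sh1: "shatters F K" if "K \<in> sh F1" for K
    unfolding shatters_def
  proof (intro allI impI)
    fix T assume "T \<subseteq> K"
    then obtain S where S: "S \<in> F1" "S \<inter> K = T"
      using \<open>K \<in> sh F1\<close> unfolding sh_def shatters_def by blast
    then have "insert x S \<in> F" using F1_iff F1J insert.hyps by blast
    moreover have "insert x S \<inter> K = T" using S \<open>K \<in> sh F1\<close> insert.hyps by (auto simp: sh_def)
    ultimately show "\<exists>S\<in>F. S \<inter> K = T" by blast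
  qed
  have sh01: "shatters F (insert x K)" if K: "K \<in> sh F0 \<inter> sh F1" for K
    unfolding shatters_def
  proof (intro allI impI)
    fix T assume T: "T \<subseteq> insert x K"
    have xK: "x \<notin> K" using K insert.hyps by (auto simp: sh_def)
    have "T - {x} \<subseteq> K" using T by blast
    moreover have "shatters F0 K" "shatters F1 K" using K by (simp_all add: sh_def)
    ultimately have traces: "\<exists>S\<in>F0. S \<inter> K = T - {x}" "\<exists>S\<in>F1. S \<inter> K = T - {x}"
      by (simp_all add: shatters_def)
    show "\<exists>S\<in>F. S \<inter> insert x K = T"
    proof (cases "x \<in> T")
      case True
      obtain S where S: "S \<in> F1" "S \<inter> K = T - {x}"
        using traces by auto
      then have "insert x S \<in> F" using F1_iff F1J insert.hyps by blast
      moreover have "insert x S \<inter> insert x K = T" using S True by blast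
      ultimately show ?thesis by blast
    next
      case False
      obtain S where S: "S \<in> F0" "S \<inter> K = T - {x}"
        using traces by auto
      then have "S \<in> F" "S \<inter> insert x K = T" using False unfolding F0_def by auto
      then show ?thesis by blast
    qed
  qed
  have "F = F0 \<union> {S \<in> F. x \<in> S}" unfolding F0_def by blast
  then have "card F = card (F0 \<union> {S \<in> F. x \<in> S})" by simp
  also have "\<dots> = card F0 + card {S \<in> F. x \<in> S}"
    using finF by (intro card_Un_disjoint) (auto simp: F0_def)
  also have "card {S \<in> F. x \<in> S} = card F1"
    unfolding F1_def by (rule card_image [symmetric]) (auto simp: inj_on_def)
  also have "card F0 + card F1 \<le> card (sh F0) + card (sh F1)"
    unfolding sh_def by (intro add_mono insert.IH F0J F1J)
  also have "\<dots> = card (sh F0 \<union> sh F1) + card (sh F0 \<inter> sh F1)"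
    by (rule card_Un_Int [OF fin_sh fin_sh])
  also have "card (sh F0 \<inter> sh F1) = card (insert x ` (sh F0 \<inter> sh F1))"
    using insert.hyps by (intro card_image [symmetric]) (auto simp: inj_on_def sh_def)
  also have "card (sh F0 \<union> sh F1) + card (insert x ` (sh F0 \<inter> sh F1))
      = card ((sh F0 \<union> sh F1) \<union> insert x ` (sh F0 \<inter> sh F1))"
    using fin_sh insert.hyps by (intro card_Un_disjoint [symmetric]) (auto simp: sh_def)
  also have "\<dots> \<le> card {K. K \<subseteq> insert x J \<and> shatters F K}"
  proof (rule card_mono)
    show "finite {K. K \<subseteq> insert x J \<and> shatters F K}"
      using \<open>finite J\<close> by simp
    show "(sh F0 \<union> sh F1) \<union> insert x ` (sh F0 \<inter> sh F1) \<subseteq> {K. K \<subseteq> insert x J \<and> shatters F K}"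
      using sh0 sh1 sh01 by (fastforce simp: sh_def)
  qed
  finally show ?case .
qed

lemma sauer_shelah:
  assumes "finite J" and "F \<subseteq> Pow J" and "(\<Sum>k<n. card J choose k) < card F"
  obtains K where "K \<subseteq> J" and "card K = n" and "shatters F K"
proof -
  have "\<exists>K\<subseteq>J. shatters F K \<and> n \<le> card K"
  proof (rule ccontr)
    assume "\<not> ?thesis"
    then have "{K. K \<subseteq> J \<and> shatters F K} \<subseteq> (\<Union>k<n. {K. K \<subseteq> J \<and> card K = k})"
      by (auto simp: not_le)
    then have "card {K. K \<subseteq> J \<and> shatters F K} \<le> card (\<Union>k<n. {K. K \<subseteq> J \<and> card K = k})"
      using \<open>finite J\<close> by (intro card_mono) auto
    also have "\<dots> \<le> (\<Sum>k<n. card {K. K \<subseteq> J \<and> card K = k})"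
      by (rule card_UN_le) simp
    also have "\<dots> = (\<Sum>k<n. card J choose k)"
      using \<open>finite J\<close> by (simp add: n_subsets)
    finally show False
      using pajor [OF assms(1,2)] assms(3) by linarith
  qed
  then obtain K where K: "K \<subseteq> J" "shatters F K" "n \<le> card K" by blast
  obtain L where "L \<subseteq> K" "card L = n"
    using obtain_subset_with_card_n [OF K(3)] by metis
  then show thesis
    using that [of L] K shatters_subset by blast
qed

section \<open>Cells of a family in a Boolean algebra\<close>

definition cells :: "('i \<Rightarrow> 'a::boolean_algebra) \<Rightarrow> 'i set \<Rightarrow> 'i set set" where
  "cells c J = {S. S \<subseteq> J \<and> (\<exists>y. y \<noteq> bot \<and> (\<forall>i\<in>J. y \<le> (if i \<in> S then c i else - c i)))}"

lemma le_finite_meet_iff: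
  assumes "finite A"
  shows "y \<le> finite_meet A \<longleftrightarrow> (\<forall>a\<in>A. y \<le> a)"
  using assms by (simp add: finite_meet_def Inf_fin.bounded_iff)

text \<open>
  Independence only has to be tested on full cells: a condition on disjoint \<open>I1\<close> and \<open>I2\<close>
  follows from the one on \<open>I1\<close> and \<open>I - I1\<close>, since \<open>I2 \<subseteq> I - I1\<close>.
\<close>

lemma independent_family_iff_cells:
  assumes "finite I"
  shows "independent_family a I \<longleftrightarrow> cells a I = Pow I"
proof
  assume ind: "independent_family a I"
  show "cells a I = Pow I"
  proof (intro equalityI subsetI)
    fix S assume "S \<in> Pow I"
    let ?y = "inf (finite_meet (a ` S)) (finite_meet ((\<lambda>i. - a i) ` (I - S)))"
    have fin: "finite S" "finite (I - S)"
      using \<open>S \<in> Pow I\<close> assms finite_subset by auto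
    have "?y \<noteq> bot"
      using ind fin \<open>S \<in> Pow I\<close> unfolding independent_family_def by blast
    moreover have "?y \<le> a i" if "i \<in> S" for i
      using le_finite_meet_iff [of "a ` S"] fin that by (meson finite_imageI imageI inf_le1)
    moreover have "?y \<le> - a i" if "i \<in> I - S" for i
      using le_finite_meet_iff [of "(\<lambda>i. - a i) ` (I - S)"] fin that
      by (metis (no_types, lifting) finite_imageI imageI inf_le2)
    ultimately show "S \<in> cells a I"
      using \<open>S \<in> Pow I\<close> unfolding cells_def by (auto intro!: exI [of _ ?y])
  qed (auto simp: cells_def)
next
  assume cells: "cells a I = Pow I"
  show "independent_family a I"
    unfolding independent_family_def
  proof (intro allI impI)
    fix I1 I2
    assume *: "finite I1 \<and> finite I2 \<and> I1 \<subseteq> I \<and> I2 \<subseteq> I \<and> I1 \<inter> I2 = {}"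
    then have "I1 \<in> cells a I" using cells by blast
    then obtain y where y: "y \<noteq> bot" "\<forall>i\<in>I. y \<le> (if i \<in> I1 then a i else - a i)"
      unfolding cells_def by blast
    have "y \<le> a i" if "i \<in> I1" for i using bspec [OF y(2), of i] that * by auto
    moreover have "y \<le> - a i" if "i \<in> I2" for i using bspec [OF y(2), of i] that * by (cases "i \<in> I1") auto
    ultimately have "y \<le> inf (finite_meet (a ` I1)) (finite_meet ((\<lambda>i. - a i) ` I2))"
      using * by (simp add: le_finite_meet_iff)
    with \<open>y \<noteq> bot\<close> show "inf (finite_meet (a ` I1)) (finite_meet ((\<lambda>i. - a i) ` I2)) \<noteq> bot"
      using bot_unique by metis
  qed
qed

text \<open>
  Every nonzero element meets some cell: as \<open>y = (y \<sqinter> c i) \<squnion> (y \<sqinter> - c i)\<close>, one of the two parts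
  is nonzero, and it can be cut further by the remaining members.
\<close>

lemma exists_cell_below:
  fixes x :: "'a::boolean_algebra"
  assumes "finite J" and "x \<noteq> bot"
  obtains S y where "S \<subseteq> J" and "y \<noteq> bot" and "y \<le> x"
    and "\<And>i. i \<in> J \<Longrightarrow> y \<le> (if i \<in> S then c i else - c i)"
proof -
  have "\<exists>y. y \<noteq> bot \<and> y \<le> x \<and> (\<forall>i\<in>J. y \<le> c i \<or> y \<le> - c i)"
    using assms(1)
  proof (induction J rule: finite_induct)
    case empty
    then show ?case using \<open>x \<noteq> bot\<close> by auto
  next
    case (insert j J)
    then obtain y where y: "y \<noteq> bot" "y \<le> x" "\<forall>i\<in>J. y \<le> c i \<or> y \<le> - c i" by blast
    have "y = sup (inf y (c j)) (inf y (- c j))"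
      by (simp flip: inf_sup_distrib1)
    with \<open>y \<noteq> bot\<close> have "inf y (c j) \<noteq> bot \<or> inf y (- c j) \<noteq> bot"
      by (metis sup_bot.right_neutral)
    then obtain z where "z \<noteq> bot" "z \<le> y" "z \<le> c j \<or> z \<le> - c j"
      by (meson inf_le1 inf_le2)
    with y show ?case
      by (intro exI [of _ z]) (auto intro: order_trans)
  qed
  then obtain y where "y \<noteq> bot" "y \<le> x" "\<forall>i\<in>J. y \<le> c i \<or> y \<le> - c i" by blast
  then show thesis by (intro that [of "{i\<in>J. y \<le> c i}" y]) auto
qed

text \<open>
  Within a single cell the variables behave like truth values, and evaluation in the
  two-element algebra \<^typ>\<open>bool\<close> tells whether the cell lies inside or outside the value of the
  polynomial.
\<close>

lemma below_bpoly_eval: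
  assumes "\<And>i. i \<in> bpoly_vars p \<Longrightarrow> y \<le> (if v i then a i else - a i)"
  shows "y \<le> (if bpoly_eval v p then bpoly_eval a p else - bpoly_eval a p)"
  using assms
proof (induction p)
  case (Meet p q)
  then have "y \<le> (if bpoly_eval v p then bpoly_eval a p else - bpoly_eval a p)"
    and "y \<le> (if bpoly_eval v q then bpoly_eval a q else - bpoly_eval a q)" by simp_all
  then show ?case by (auto split: if_splits intro: le_supI1 le_supI2)
next
  case (Join p q)
  then have "y \<le> (if bpoly_eval v p then bpoly_eval a p else - bpoly_eval a p)"
    and "y \<le> (if bpoly_eval v q then bpoly_eval a q else - bpoly_eval a q)" by simp_all
  then show ?case by (auto split: if_splits intro: le_supI1 le_supI2)
qed (auto split: if_splits)

text \<open>
  A cell of the whole family that traces \<open>T\<close> on \<open>K\<close> witnesses that \<open>T\<close> is a cell of the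
  subfamily indexed by \<open>K\<close>; so if \<open>K\<close> is shattered, this subfamily is independent. This remains
  true if members repeat, because then no cell separates two indices of the same element and
  \<open>K\<close> cannot contain both.
\<close>

lemma contains_independent_if_shattered:
  assumes "shatters (cells c J) K" and "K \<subseteq> J" and "finite J" and "\<And>i. i \<in> K \<Longrightarrow> c i \<in> E"
  shows "contains_independent E (card K)"
proof -
  have "finite K" using assms finite_subset by blast
  then obtain f where f: "bij_betw f {..<card K} K"
    using ex_bij_betw_nat_finite [of K] by (auto simp: atLeast0LessThan)
  have "cells (c \<circ> f) {..<card K} = Pow {..<card K}"
  proof (intro equalityI subsetI)
    fix T assume T: "T \<in> Pow {..<card K}"
    then have "f ` T \<subseteq> K" using f by (auto simp: bij_betw_def)
    then obtain S where S: "S \<in> cells c J" "S \<inter> K = f ` T"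
      using assms(1) unfolding shatters_def by blast
    then obtain y where y: "y \<noteq> bot" "\<And>i. i \<in> J \<Longrightarrow> y \<le> (if i \<in> S then c i else - c i)"
      unfolding cells_def by blast
    have "y \<le> (if k \<in> T then (c \<circ> f) k else - (c \<circ> f) k)" if "k < card K" for k
    proof -
      have "f k \<in> K" using f that by (auto simp: bij_betw_def)
      moreover have "f k \<in> f ` T \<longleftrightarrow> k \<in> T"
        using f that T by (intro inj_on_image_mem_iff) (auto simp: bij_betw_def)
      ultimately have "f k \<in> S \<longleftrightarrow> k \<in> T" using S(2) by blast
      then show ?thesis using y(2) [of "f k"] \<open>f k \<in> K\<close> assms(2) by auto
    qed
    with T y(1) show "T \<in> cells (c \<circ> f) {..<card K}" unfolding cells_def by blast
  qed (auto simp: cells_def)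
  then have "independent_family (c \<circ> f) {..<card K}"
    by (simp add: independent_family_iff_cells)
  moreover have "(c \<circ> f) k \<in> E" if "k < card K" for k
    using assms(4) f that by (auto simp: bij_betw_def)
  ultimately show ?thesis unfolding contains_independent_def by blast
qed

section \<open>Independent values of a Boolean polynomial\<close>

text \<open>
  The minimum defining \<open>I(n, r)\<close> is attained: the sum is at most \<open>n * (r * s + 1) ^ n\<close>, and
  \<open>x ^ n / exp x\<close> tends to \<open>0\<close>.
\<close>

lemma indep_bound_less:
  "(\<Sum>k<n. (r * indep_bound n r) choose k) < 2 ^ indep_bound n r"
  unfolding indep_bound_def
proof (rule LeastI_ex)
  \<comment> \<open>The factor \<open>r / ln 2 + 1\<close> turns \<open>r * s + 1\<close> into a multiple of \<open>s * ln 2\<close> as soon as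
    \<open>s * ln 2 \<ge> 1\<close>; then \<open>2 ^ s = exp (s * ln 2)\<close> is compared with a power of its own exponent.\<close>
  define C where "C = real n * (real r / ln 2 + 1) ^ n"
  have "((\<lambda>x::real. x ^ n / exp x) \<longlongrightarrow> 0) at_top"
    by (rule tendsto_power_div_exp_0)
  moreover have lim: "LIM s sequentially. real s * ln 2 :> at_top"
    by (rule filterlim_at_top_mult_tendsto_pos [OF tendsto_const _ filterlim_real_sequentially]) simp
  ultimately have "((\<lambda>s. (real s * ln 2) ^ n / exp (real s * ln 2)) \<longlongrightarrow> 0) sequentially"
    by (rule filterlim_compose)
  moreover have C0: "0 \<le> C" unfolding C_def by simp
  ultimately have "\<forall>\<^sub>F s in sequentially. (real s * ln 2) ^ n / exp (real s * ln 2) < 1 / (C + 1)"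
    by (intro order_tendstoD(2)) auto
  moreover have "\<forall>\<^sub>F s in sequentially. 1 \<le> real s * ln 2"
    using lim by (auto simp: filterlim_at_top)
  ultimately have "\<forall>\<^sub>F s in sequentially. (real s * ln 2) ^ n / exp (real s * ln 2) < 1 / (C + 1)
      \<and> 1 \<le> real s * ln 2"
    by (rule eventually_conj)
  then obtain s where s: "(real s * ln 2) ^ n / exp (real s * ln 2) < 1 / (C + 1)"
      "1 \<le> real s * ln 2"
    using eventually_happens by fastforce
  have exp_s: "exp (real s * ln 2) = 2 ^ s"
    by (simp add: exp_of_nat_mult)
  have "real (\<Sum>k<n. (r * s) choose k) \<le> real n * real (r * s + 1) ^ n"
  proof -
    have "(r * s) choose k \<le> (r * s + 1) ^ n" if "k < n" for k
    proof -
      have "(r * s) choose k \<le> (r * s) ^ k"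
        by (cases "k \<le> r * s") (auto simp: binomial_le_pow binomial_eq_0)
      also have "\<dots> \<le> (r * s + 1) ^ k" by (simp add: power_mono)
      also have "\<dots> \<le> (r * s + 1) ^ n" using that by (intro power_increasing) auto
      finally show ?thesis .
    qed
    then have "(\<Sum>k<n. (r * s) choose k) \<le> (\<Sum>k<n. (r * s + 1) ^ n)"
      by (intro sum_mono) auto
    then have "(\<Sum>k<n. (r * s) choose k) \<le> n * (r * s + 1) ^ n" by simp
    then show ?thesis by (metis of_nat_le_iff of_nat_mult of_nat_power)
  qed
  also have "\<dots> \<le> real n * ((real r / ln 2 + 1) * (real s * ln 2)) ^ n"
    using s(2) by (intro mult_left_mono power_mono) (auto simp: field_simps)
  also have "\<dots> = C * (real s * ln 2) ^ n"
    by (simp add: C_def power_mult_distrib)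
  also have "\<dots> \<le> (C + 1) * (real s * ln 2) ^ n"
    by (intro mult_right_mono) auto
  also have "\<dots> < 2 ^ s"
    using s(1) C0 unfolding exp_s by (simp add: field_simps)
  finally have "real (\<Sum>k<n. (r * s) choose k) < real (2 ^ s)" by simp
  then show "\<exists>s. (\<Sum>k<n. (r * s) choose k) < 2 ^ s"
    by (auto simp only: of_nat_less_iff)
qed

text \<open>
  A cell \<open>S\<close> of all arguments is sent to the set of those \<open>j\<close> for which \<open>p\<close> holds at the truth
  values that \<open>S\<close> gives to the \<open>j\<close>-th tuple of arguments. This map hits every cell of the
  values, because a nonzero element witnessing a cell of the values contains a cell of the arguments.
\<close>

lemma cells_of_values_from_cells_of_arguments:
  fixes a :: "'j \<Rightarrow> 'v \<Rightarrow> 'a::boolean_algebra"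
  assumes "finite J" and "finite V" and "bpoly_vars p \<subseteq> V"
  shows "cells (\<lambda>j. bpoly_eval (a j) p) J
    \<subseteq> (\<lambda>S. {j \<in> J. bpoly_eval (\<lambda>i. (j, i) \<in> S) p}) ` cells (\<lambda>(j, i). a j i) (J \<times> V)"
proof
  let ?b = "\<lambda>j. bpoly_eval (a j) p"
  fix T assume "T \<in> cells ?b J"
  then obtain x where T: "T \<subseteq> J" and x: "x \<noteq> bot" "\<And>j. j \<in> J \<Longrightarrow> x \<le> (if j \<in> T then ?b j else - ?b j)"
    unfolding cells_def by blast
  obtain S y where S: "S \<subseteq> J \<times> V" and y: "y \<noteq> bot" "y \<le> x"
    and yS: "\<And>q. q \<in> J \<times> V \<Longrightarrow>
      y \<le> (if q \<in> S then (case q of (j, i) \<Rightarrow> a j i) else - (case q of (j, i) \<Rightarrow> a j i))"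
    using exists_cell_below [of "J \<times> V" x "\<lambda>(j, i). a j i"] assms(1,2) x(1) by (metis finite_cartesian_product)
  have "bpoly_eval (\<lambda>i. (j, i) \<in> S) p \<longleftrightarrow> j \<in> T" if "j \<in> J" for j
  proof -
    have "y \<le> (if bpoly_eval (\<lambda>i. (j, i) \<in> S) p then ?b j else - ?b j)"
    proof (rule below_bpoly_eval)
      fix i assume "i \<in> bpoly_vars p"
      then show "y \<le> (if (j, i) \<in> S then a j i else - a j i)"
        using yS [of "(j, i)"] that assms(3) by auto
    qed
    moreover have "y \<le> (if j \<in> T then ?b j else - ?b j)"
      using x(2) [OF that] y(2) by (rule order_trans [rotated])
    moreover have "\<not> (y \<le> ?b j \<and> y \<le> - ?b j)"
      using y(1) by (metis bot_unique compl_inf_bot inf.bounded_iff)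
    ultimately show ?thesis by (auto split: if_splits)
  qed
  then have "T = {j \<in> J. bpoly_eval (\<lambda>i. (j, i) \<in> S) p}" using T by blast
  moreover have "S \<in> cells (\<lambda>(j, i). a j i) (J \<times> V)"
    using S y(1) yS unfolding cells_def by blast
  ultimately show "T \<in> (\<lambda>S. {j \<in> J. bpoly_eval (\<lambda>i. (j, i) \<in> S) p}) ` cells (\<lambda>(j, i). a j i) (J \<times> V)"
    by blast
qed

theorem theorem7p1:
  fixes E :: "'a::boolean_algebra set" and n r :: nat and p :: "nat bpoly"
  assumes "n \<ge> 1"
    and "\<not> contains_independent E n"
    and "r \<ge> 1"
    and "bpoly_vars p \<subseteq> {1..r}"
  shows "\<not> contains_independent (bpoly_image r p E) (indep_bound n r)"
proof
  define s where "s = indep_bound n r"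
  assume "contains_independent (bpoly_image r p E) (indep_bound n r)"
  then obtain b where b: "\<And>j. j < s \<Longrightarrow> b j \<in> bpoly_image r p E"
    and ind: "independent_family b {..<s}"
    unfolding contains_independent_def s_def by blast
  have "\<forall>j\<in>{..<s}. \<exists>a. b j = bpoly_eval a p \<and> (\<forall>i\<in>{1..r}. a i \<in> E)"
    using b unfolding bpoly_image_def by blast
  then obtain a where a: "\<And>j. j < s \<Longrightarrow> b j = bpoly_eval (a j) p"
    and aE: "\<And>j i. j < s \<Longrightarrow> i \<in> {1..r} \<Longrightarrow> a j i \<in> E"
    by (metis lessThan_iff)
  define J where "J = {..<s} \<times> {1..r}"
  define c where "c = (\<lambda>(j, i). a j i)"
  have J: "finite J" "card J = r * s" unfolding J_def by simp_all
  have cells_J: "cells c J \<subseteq> Pow J" unfolding cells_def by blast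
  have "cells b {..<s} = cells (\<lambda>j. bpoly_eval (a j) p) {..<s}"
    unfolding cells_def using a by auto
  then have "Pow {..<s} \<subseteq> (\<lambda>S. {j \<in> {..<s}. bpoly_eval (\<lambda>i. (j, i) \<in> S) p}) ` cells c J"
    using cells_of_values_from_cells_of_arguments [of "{..<s}" "{1..r}" p a] assms(4)
      independent_family_iff_cells [of "{..<s}" b] ind
    unfolding J_def c_def by simp
  then have "card (Pow {..<s}) \<le> card (cells c J)"
    using finite_subset [OF cells_J] J(1) by (intro surj_card_le) auto
  then have "(\<Sum>k<n. card J choose k) < card (cells c J)"
    using indep_bound_less [where n = n and r = r] by (simp add: J s_def card_Pow)
  then obtain K where "K \<subseteq> J" "card K = n" "shatters (cells c J) K"
    using sauer_shelah [OF J(1) cells_J] by blast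
  moreover have "c q \<in> E" if "q \<in> J" for q
    using that aE by (auto simp: J_def c_def)
  ultimately have "contains_independent E n"
    using contains_independent_if_shattered [of c J K E] J(1) by blast
  with assms(2) show False ..
qed

end
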